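(* Let $0<\alpha<1$ and let $u_0\in L^1([0,+\infty))\cap L^\infty([0,+\infty))$ be nonnegative, $u_0\not\equiv0$, and non-increasing. Let $m_0(\rho)=\int_0^\rho u_0(s)\,ds$ and let $m$ be the classical solution of $m_t+m\,(m_\rho)^\alpha=0$ constructed by characteristics and rarefaction fans from $u_0$, i.e. $m(0,\cdot)=m_0$ and, for $t>0$, $$m(t,\rho)=m_0(\rho_0)\bigl(1+\alpha\eta_0^\alpha t\bigr)^{1-\frac1\alpha},\qquad(\rho_0,\eta_0)=P_t^{-1}(\rho).$$ Then, for every $t\ge0$, $$\lim_{\rho\to+\infty}m(t,\rho)=\lim_{\rho\to+\infty}m_0(\rho).$$
   Context: $u_0(\rho^\pm)$ are the one-sided limits, with $u_0(0^-):=u_0(0^+)$. Let $D=\{(\rho_0,\eta_0):\rho_0\ge0,\ \eta_0>0,\ \eta_0\in[u_0(\rho_0^+),u_0(\rho_0^-)]\}$; for $t>0$ the map $P_t:D\to[0,+\infty)$, $P_t(\rho_0,\eta_0)=\rho_0+\alpha m_0(\rho_0)\eta_0^{\alpha-1}t$, is a bijection, so $P_t^{-1}(\rho)$ is well defined. *)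

theory Defs
  imports "HOL-Analysis.Analysis"
begin

text \<open>
  The datum \<open>u0\<close> is a function on \<open>[0, \<infinity>)\<close>, encoded as a total function on the reals.
  Its values at negative arguments are never used by the definitions below.
\<close>

definition right_lim :: "(real \<Rightarrow> real) \<Rightarrow> real \<Rightarrow> real" where
  "right_lim u0 \<rho> = Lim (at_right \<rho>) u0"

text \<open>The convention \<open>u0(0-) := u0(0+)\<close> is built in.\<close>

definition left_lim :: "(real \<Rightarrow> real) \<Rightarrow> real \<Rightarrow> real" where
  "left_lim u0 \<rho> = (if \<rho> = 0 then Lim (at_right 0) u0 else Lim (at_left \<rho>) u0)"

definition mass :: "(real \<Rightarrow> real) \<Rightarrow> real \<Rightarrow> real" where
  "mass u0 \<rho> = (LINT s:{0..\<rho>}|lebesgue. u0 s)"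

definition char_dom :: "(real \<Rightarrow> real) \<Rightarrow> (real \<times> real) set" where
  "char_dom u0 = {(\<rho>\<^sub>0, \<eta>\<^sub>0). \<rho>\<^sub>0 \<ge> 0 \<and> \<eta>\<^sub>0 > 0 \<and> \<eta>\<^sub>0 \<in> {right_lim u0 \<rho>\<^sub>0 .. left_lim u0 \<rho>\<^sub>0}}"

definition char_map :: "real \<Rightarrow> (real \<Rightarrow> real) \<Rightarrow> real \<Rightarrow> real \<times> real \<Rightarrow> real" where
  "char_map \<alpha> u0 t = (\<lambda>(\<rho>\<^sub>0, \<eta>\<^sub>0). \<rho>\<^sub>0 + \<alpha> * mass u0 \<rho>\<^sub>0 * \<eta>\<^sub>0 powr (\<alpha> - 1) * t)"

text \<open>
  The solution by characteristics and rarefaction fans. For \<open>t > 0\<close> the map \<open>char_map \<alpha> u0 t\<close>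
  is a bijection from \<open>char_dom u0\<close> onto \<open>[0, \<infinity>)\<close> under the standing assumptions on \<open>\<alpha>\<close> and
  \<open>u0\<close>, and \<open>inv_into\<close> is then its inverse. Only \<open>t \<ge> 0\<close> and \<open>\<rho> \<ge> 0\<close> are meaningful.
\<close>

definition char_sol :: "real \<Rightarrow> (real \<Rightarrow> real) \<Rightarrow> real \<Rightarrow> real \<Rightarrow> real" where
  "char_sol \<alpha> u0 t \<rho> =
     (if t = 0 then mass u0 \<rho>
      else case inv_into (char_dom u0) (char_map \<alpha> u0 t) \<rho> of
        (\<rho>\<^sub>0, \<eta>\<^sub>0) \<Rightarrow> mass u0 \<rho>\<^sub>0 * (1 + \<alpha> * \<eta>\<^sub>0 powr \<alpha> * t) powr (1 - 1 / \<alpha>))"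

end

theory Submission
  imports Defs
begin

text \<open>
  Let \<open>(\<rho>\<^sub>0, \<eta>\<^sub>0)\<close> be the foot of the characteristic through \<open>(t, \<rho>)\<close> and let \<open>L\<close> be the total
  mass. Since \<open>\<eta>\<^sub>0 \<rho>\<^sub>0 \<le> m\<^sub>0(\<rho>\<^sub>0) \<le> L\<close>, a lower bound \<open>\<eta>\<^sub>0 \<ge> \<delta>\<close> forces
  \<open>\<rho> \<le> L / \<delta> + \<alpha> L \<delta>\<^bsup>\<alpha> - 1\<^esup> t\<close>; hence \<open>\<eta>\<^sub>0 \<rightarrow> 0\<close> as \<open>\<rho> \<rightarrow> \<infinity>\<close>. The datum is at most \<open>\<eta>\<^sub>0\<close> to the right
  of \<open>\<rho>\<^sub>0\<close>, so \<open>m\<^sub>0(R) - \<eta>\<^sub>0 R \<le> m\<^sub>0(\<rho>\<^sub>0) \<le> L\<close> for every \<open>R \<ge> 0\<close>, which squeezes \<open>m(t, \<rho>)\<close> between a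
  quantity tending to \<open>m\<^sub>0(R)\<close> and \<open>L\<close>.
\<close>

section \<open>One-sided limits of a non-increasing datum\<close>

locale decreasing_datum =
  fixes u0 :: "real \<Rightarrow> real"
  assumes integrable: "set_integrable lebesgue {0..} u0"
    and nonneg: "s \<ge> 0 \<Longrightarrow> u0 s \<ge> 0"
    and nonzero: "\<not> (AE s in lebesgue. s \<ge> 0 \<longrightarrow> u0 s = 0)"
    and antimono: "antimono_on {0..} u0"
begin

lemma decreasing: "0 \<le> a \<Longrightarrow> a \<le> b \<Longrightarrow> u0 b \<le> u0 a"
  using antimono by (auto simp: monotone_on_def)

text \<open>\<open>Lim\<close> is informative only once some limit exists; monotonicity and
  boundedness near r supply one. Negating \<open>u0\<close> gives the non-decreasing function that
  \<open>Lim_right_bound\<close> expects.\<close>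

lemma tendsto_right_lim:
  assumes "0 \<le> r"
  shows "(u0 \<longlongrightarrow> right_lim u0 r) (at_right r)"
proof -
  have "((\<lambda>s. - u0 s) \<longlongrightarrow> Inf ((\<lambda>s. - u0 s) ` ({r<..} \<inter> UNIV))) (at r within ({r<..} \<inter> UNIV))"
    by (rule Lim_right_bound[where K = "- u0 r"]) (use assms decreasing in auto)
  from tendsto_minus[OF this] obtain k where k: "(u0 \<longlongrightarrow> k) (at_right r)"
    by auto
  then show ?thesis
    unfolding right_lim_def using tendsto_Lim[OF _ k] by auto
qed

lemma tendsto_left_lim:
  assumes "0 < r"
  shows "(u0 \<longlongrightarrow> left_lim u0 r) (at_left r)"
proof -
  \<comment> \<open>Monotonicity is known only at nonnegative arguments, so the limit is first taken
    within (0, r), where 0 bounds \<open>- u0\<close> from above.\<close>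
  have "((\<lambda>s. - u0 s) \<longlongrightarrow> Sup ((\<lambda>s. - u0 s) ` ({..<r} \<inter> {0<..}))) (at r within ({..<r} \<inter> {0<..}))"
    by (rule Lim_left_bound[where K = 0]) (use assms decreasing nonneg in auto)
  moreover have "at r within ({..<r} \<inter> {0<..}) = at_left r"
    by (rule at_within_nhd[where S = "{0<..}"]) (use assms in auto)
  ultimately obtain k where k: "((\<lambda>s. - u0 s) \<longlongrightarrow> k) (at_left r)"
    by auto
  from tendsto_minus[OF this] have k: "(u0 \<longlongrightarrow> - k) (at_left r)" by simp
  then show ?thesis
    unfolding left_lim_def using tendsto_Lim[OF _ k] assms by auto
qed

lemma le_right_lim:
  assumes "0 \<le> r" "r < s"
  shows "u0 s \<le> right_lim u0 r"
proof (rule tendsto_lowerbound[OF tendsto_right_lim[OF assms(1)]])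
  show "\<forall>\<^sub>F x in at_right r. u0 s \<le> u0 x"
    using eventually_at_right_less[of r] eventually_at_right_real[OF assms(2)]
    by eventually_elim (use assms decreasing in auto)
qed auto

lemma left_lim_le:
  assumes "0 \<le> s" "s < r"
  shows "left_lim u0 r \<le> u0 s"
proof (rule tendsto_upperbound[OF tendsto_left_lim])
  show "\<forall>\<^sub>F x in at_left r. u0 x \<le> u0 s"
    using eventually_at_left_real[OF assms(2)]
    by eventually_elim (use assms decreasing in auto)
qed (use assms in auto)

text \<open>Every value at a positive argument lies below this limit, so a nonpositive limit would
  make the datum vanish almost everywhere.\<close>

lemma right_lim_0_pos: "0 < right_lim u0 0"
proof (rule ccontr)
  assume "\<not> ?thesis"
  then have zero: "u0 s = 0" if "0 < s" for s
    using le_right_lim[of 0 s] nonneg[of s] that by auto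
  have "AE s in lebesgue. s \<noteq> (0::real)"
    by (rule AE_I'[of "{0}"]) auto
  then have "AE s in lebesgue. s \<ge> 0 \<longrightarrow> u0 s = 0"
    by eventually_elim (use zero in auto)
  with nonzero show False by simp
qed

section \<open>The mass function: increments, positivity, continuity\<close>

lemma set_integrable_Icc: "0 \<le> a \<Longrightarrow> set_integrable lebesgue {a..b} u0"
  by (rule set_integrable_subset[OF integrable]) auto

text \<open>The open interval matters: one-sided limits at a and b control \<open>u0\<close>
  strictly between them, not at the endpoints.\<close>

lemma mass_diff:
  assumes "0 \<le> a" "a \<le> b"
  shows "u0 integrable_on {a<..<b}" "mass u0 b - mass u0 a = integral {a<..<b} u0"
proof -
  show "u0 integrable_on {a<..<b}"
    using set_lebesgue_integral_eq_integral(1)[OF set_integrable_Icc[of a b]] assms(1)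
    by (simp add: integrable_on_open_interval_real)
  have "mass u0 c = integral {0..c} u0" for c
    unfolding mass_def
    by (rule set_lebesgue_integral_eq_integral(2)[OF set_integrable_Icc]) simp
  moreover have "integral {0..a} u0 + integral {a..b} u0 = integral {0..b} u0"
    by (rule Henstock_Kurzweil_Integration.integral_combine)
      (use assms set_lebesgue_integral_eq_integral(1)[OF set_integrable_Icc] in auto)
  ultimately show "mass u0 b - mass u0 a = integral {a<..<b} u0"
    by (simp add: integral_open_interval_real)
qed

lemma mass_diff_le:
  assumes "0 \<le> a" "a \<le> b" "\<And>s. a < s \<Longrightarrow> s < b \<Longrightarrow> u0 s \<le> C"
  shows "mass u0 b - mass u0 a \<le> C * (b - a)"
proof -
  have "integral {a<..<b} u0 \<le> integral {a<..<b} (\<lambda>_. C)"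
    by (rule integral_le) (use mass_diff assms in \<open>auto simp: integrable_on_open_interval_real\<close>)
  then show ?thesis
    using mass_diff(2)[OF assms(1,2)] assms(2)
    by (simp flip: integral_open_interval_real add: mult.commute)
qed

lemma mass_diff_ge:
  assumes "0 \<le> a" "a \<le> b" "\<And>s. a < s \<Longrightarrow> s < b \<Longrightarrow> C \<le> u0 s"
  shows "C * (b - a) \<le> mass u0 b - mass u0 a"
proof -
  have "integral {a<..<b} (\<lambda>_. C) \<le> integral {a<..<b} u0"
    by (rule integral_le) (use mass_diff assms in \<open>auto simp: integrable_on_open_interval_real\<close>)
  then show ?thesis
    using mass_diff(2)[OF assms(1,2)] assms(2)
    by (simp flip: integral_open_interval_real add: mult.commute)
qed

lemma mass_0: "mass u0 0 = 0"
  unfolding mass_def using set_lebesgue_integral_eq_integral(2)[OF set_integrable_Icc[of 0 0]] by simp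

lemma mass_mono: "0 \<le> a \<Longrightarrow> a \<le> b \<Longrightarrow> mass u0 a \<le> mass u0 b"
  using mass_diff_ge[of a b 0] nonneg by auto

lemma mass_nonneg: "0 \<le> r \<Longrightarrow> 0 \<le> mass u0 r"
  using mass_mono[of 0 r] mass_0 by simp

text \<open>Some s in (0, r) has \<open>u0 s > 0\<close> because the right limit at 0 is positive;
  by monotonicity the mass up to s is at least \<open>u0 s * s\<close>.\<close>

lemma mass_pos:
  assumes "0 < r"
  shows "0 < mass u0 r"
proof -
  have "\<forall>\<^sub>F s in at_right 0. u0 s > 0"
    by (rule order_tendstoD(1)[OF tendsto_right_lim right_lim_0_pos]) simp
  moreover have "\<forall>\<^sub>F s in at_right 0. s \<in> {0<..<r}"
    by (rule eventually_at_right_real[OF assms])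
  ultimately have "\<forall>\<^sub>F s in at_right 0. u0 s > 0 \<and> s \<in> {0<..<r}"
    by eventually_elim auto
  then obtain s where s: "u0 s > 0" "0 < s" "s < r"
    using eventually_happens[of _ "at_right (0::real)"] by auto
  have "0 < u0 s * s" using s by simp
  also have "\<dots> \<le> mass u0 s"
    using mass_diff_ge[of 0 s "u0 s"] decreasing s mass_0 by auto
  also have "\<dots> \<le> mass u0 r"
    using s by (intro mass_mono) auto
  finally show ?thesis .
qed

lemma continuous_on_mass: "continuous_on {0..} (mass u0)"
proof (rule lipschitz_on_continuous_on[where L = "u0 0"], rule lipschitz_onI)
  have *: "\<bar>mass u0 b - mass u0 a\<bar> \<le> u0 0 * \<bar>b - a\<bar>" if "0 \<le> a" "a \<le> b" for a b
    using mass_diff_le[of a b "u0 0"] mass_mono[of a b] decreasing that by auto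
  show "dist (mass u0 x) (mass u0 y) \<le> u0 0 * dist x y" if "x \<in> {0..}" "y \<in> {0..}" for x y
    using *[of x y] *[of y x] that by (cases "x \<le> y") (auto simp: dist_real_def abs_minus_commute)
qed (simp add: nonneg)

lemma tendsto_mass_within:
  assumes "0 \<le> r"
  shows "(mass u0 \<longlongrightarrow> mass u0 r) (at r within {0..})"
  using continuous_on_mass assms by (auto simp: continuous_on_def)

lemma tendsto_mass_right: "0 \<le> r \<Longrightarrow> (mass u0 \<longlongrightarrow> mass u0 r) (at_right r)"
  by (rule tendsto_within_subset[OF tendsto_mass_within]) auto

lemma tendsto_mass_left:
  assumes "0 < r"
  shows "(mass u0 \<longlongrightarrow> mass u0 r) (at_left r)"
proof -
  have "(mass u0 \<longlongrightarrow> mass u0 r) (at r within ({..<r} \<inter> {0<..}))"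
    by (rule tendsto_within_subset[OF tendsto_mass_within]) (use assms in auto)
  moreover have "at r within ({..<r} \<inter> {0<..}) = at_left r"
    by (rule at_within_nhd[where S = "{0<..}"]) (use assms in auto)
  ultimately show ?thesis by simp
qed

section \<open>Total mass as the limit at infinity\<close>

definition total_mass :: real where
  "total_mass = (LINT s:{0..}|lebesgue. u0 s)"

lemma tendsto_mass_at_top: "(mass u0 \<longlongrightarrow> total_mass) at_top"
  unfolding mass_def[abs_def] total_mass_def
  by (rule tendsto_set_lebesgue_integral_at_top) (use integrable in auto)

lemma mass_le_total_mass:
  assumes "0 \<le> r"
  shows "mass u0 r \<le> total_mass"
proof (rule tendsto_lowerbound[OF tendsto_mass_at_top])
  show "\<forall>\<^sub>F s in at_top. mass u0 r \<le> mass u0 s"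
    using eventually_ge_at_top[of r] by eventually_elim (rule mass_mono[OF assms])
qed simp

section \<open>Mass estimates at the foot of a characteristic\<close>

text \<open>On (0, r) the datum is at least its left limit at r, hence at least \<eta>.\<close>

lemma char_dom_mult_le_mass:
  assumes "(r, \<eta>) \<in> char_dom u0"
  shows "\<eta> * r \<le> mass u0 r"
proof -
  have "\<eta> \<le> u0 s" if "0 < s" "s < r" for s
    using left_lim_le[of s r] that assms by (auto simp: char_dom_def)
  then show ?thesis
    using mass_diff_ge[of 0 r \<eta>] assms mass_0 by (auto simp: char_dom_def)
qed

text \<open>Beyond r the datum is at most \<eta>, so the mass between r and R is at most \<eta> (R -
  r). If R < r, monotonicity of the mass suffices.\<close>

lemma char_dom_mass_ge:
  assumes "(r, \<eta>) \<in> char_dom u0" "0 \<le> R"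
  shows "mass u0 R - \<eta> * R \<le> mass u0 r"
proof (cases "r \<le> R")
  case True
  have r: "0 \<le> r" "0 < \<eta>" "right_lim u0 r \<le> \<eta>" using assms by (auto simp: char_dom_def)
  then have "u0 s \<le> \<eta>" if "r < s" for s
    using le_right_lim[of r s] that by auto
  then have "mass u0 R - mass u0 r \<le> \<eta> * (R - r)"
    using mass_diff_le[of r R \<eta>] True r by auto
  also have "\<dots> \<le> \<eta> * R" using r by simp
  finally show ?thesis by simp
next
  case False
  then have "mass u0 R \<le> mass u0 r" using assms by (intro mass_mono) auto
  moreover have "0 \<le> \<eta> * R" using assms by (auto simp: char_dom_def)
  ultimately show ?thesis by simp
qed

section \<open>Every positive point is reached by a characteristic\<close>

text \<open>
  For \<open>\<eta> > 0\<close>, \<open>char_map \<alpha> u0 t (r, \<eta>) \<le> \<rho>\<close> says \<open>\<alpha> m\<^sub>0(r) t \<le> (\<rho> - r) \<eta>\<^bsup>1 - \<alpha>\<^esup>\<close>. In this form, with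
  \<open>\<eta> = u0 r\<close>, the inequality also makes sense where \<open>u0\<close> vanishes. The foot of the
  characteristic is the point where the decreasing function \<open>g\<close> below changes sign.
\<close>
lemma char_map_surj:
  assumes \<alpha>: "0 < \<alpha>" "\<alpha> < 1" and t: "0 < t" and \<rho>: "0 < \<rho>"
  shows "\<rho> \<in> char_map \<alpha> u0 t ` char_dom u0"
proof -
  define g where "g r = (\<rho> - r) * u0 r powr (1 - \<alpha>) - \<alpha> * mass u0 r * t" for r
  have g_decreasing: "g b \<le> g a" if "0 \<le> a" "a \<le> b" "b \<le> \<rho>" for a b
  proof -
    have "(\<rho> - b) * u0 b powr (1 - \<alpha>) \<le> (\<rho> - a) * u0 a powr (1 - \<alpha>)"
      using that \<alpha> nonneg decreasing by (intro mult_mono powr_mono2) auto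
    moreover have "\<alpha> * mass u0 a * t \<le> \<alpha> * mass u0 b * t"
      using that \<alpha> t mass_mono[of a b] by (intro mult_right_mono mult_left_mono) auto
    ultimately show ?thesis by (simp add: g_def)
  qed
  define A where "A = {r. 0 \<le> r \<and> r \<le> \<rho> \<and> 0 \<le> g r}"
  \<comment> \<open>If \<open>u0\<close> jumps at z, \<open>g\<close> need not vanish there; the
    signs of \<open>g\<close> on the two sides are therefore passed to its one-sided limits.\<close>
  define z where "z = Sup A"
  have bdd: "bdd_above A" by (auto simp: A_def bdd_above_def)
  have "0 \<in> A" using \<rho> by (simp add: A_def g_def mass_0)
  have g_right: "(g \<longlongrightarrow> (\<rho> - r) * right_lim u0 r powr (1 - \<alpha>) - \<alpha> * mass u0 r * t) (at_right r)"
    if "0 \<le> r" for r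
  proof -
    \<comment> \<open>\<open>right_lim u0 r\<close> may be 0; \<open>tendsto_powr'\<close> then asks
      for an eventually nonnegative base and a positive exponent.\<close>
    have "\<forall>\<^sub>F s in at_right r. 0 \<le> u0 s"
      using eventually_at_right_less[of r] by eventually_elim (use that nonneg in auto)
    then show ?thesis
      unfolding g_def[abs_def] using \<alpha> that
      by (intro tendsto_intros tendsto_powr' tendsto_right_lim tendsto_mass_right) auto
  qed
  \<comment> \<open>The limit of \<open>g\<close> at 0 is \<rho> times a power of
    \<open>right_lim u0 0\<close>, hence positive. This yields z > 0, so the left limit at z is a
    genuine one and the mass at z is positive.\<close>
  have "\<forall>\<^sub>F r in at_right 0. 0 < g r"
    by (rule order_tendstoD(1)[OF g_right]) (use \<rho> right_lim_0_pos mass_0 in auto)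
  moreover have "\<forall>\<^sub>F r in at_right 0. r \<in> {0<..<\<rho>}"
    by (rule eventually_at_right_real[OF \<rho>])
  ultimately have "\<forall>\<^sub>F r in at_right 0. r \<in> A \<and> 0 < r"
    by eventually_elim (auto simp: A_def)
  then obtain r1 where "r1 \<in> A" "0 < r1"
    using eventually_happens[of _ "at_right (0::real)"] by auto
  then have z_pos: "0 < z"
    using cSup_upper[OF _ bdd] unfolding z_def by fastforce
  have z_le: "z \<le> \<rho>"
    unfolding z_def by (rule cSup_least) (use \<open>0 \<in> A\<close> in \<open>auto simp: A_def\<close>)
  have below: "0 \<le> g r" if "0 \<le> r" and r_less: "r < z" for r
  proof -
    obtain a where "a \<in> A" "r < a"
      using r_less less_cSup_iff[OF _ bdd, of r] \<open>0 \<in> A\<close> unfolding z_def by blast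
    then show ?thesis using g_decreasing[of r a] \<open>0 \<le> r\<close> by (auto simp: A_def)
  qed
  have above: "g r < 0" if "z < r" "r \<le> \<rho>" for r
  proof (rule ccontr)
    assume "\<not> g r < 0"
    then have "r \<in> A" using that z_pos by (auto simp: A_def)
    then show False using cSup_upper[OF _ bdd] that unfolding z_def by fastforce
  qed
  let ?l = "left_lim u0 z" and ?k = "right_lim u0 z" and ?M = "\<alpha> * mass u0 z * t"
  have M: "0 < ?M" using mass_pos[OF z_pos] \<alpha> t by simp
  have nonneg_near: "\<forall>\<^sub>F s in at_left z. 0 \<le> u0 s \<and> 0 \<le> g s"
    using eventually_at_left_real[OF z_pos] by eventually_elim (use nonneg below in auto)
  have l_nonneg: "0 \<le> ?l"
    by (rule tendsto_lowerbound[OF tendsto_left_lim[OF z_pos]])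
      (use nonneg_near in \<open>auto elim: eventually_mono\<close>)
  have "(g \<longlongrightarrow> (\<rho> - z) * ?l powr (1 - \<alpha>) - ?M) (at_left z)"
    unfolding g_def[abs_def] using \<alpha> nonneg_near z_pos
    by (intro tendsto_intros tendsto_powr' tendsto_left_lim tendsto_mass_left)
      (auto elim: eventually_mono)
  then have "0 \<le> (\<rho> - z) * ?l powr (1 - \<alpha>) - ?M"
    by (rule tendsto_lowerbound) (use nonneg_near in \<open>auto elim: eventually_mono\<close>)
  then have M_le: "?M \<le> (\<rho> - z) * ?l powr (1 - \<alpha>)" by simp
  \<comment> \<open>At z = \<rho> the right side of \<open>M_le\<close> would vanish, although
    \<open>?M\<close> is positive.\<close>
  have z_less: "z < \<rho>"
  proof (rule ccontr)
    assume "\<not> z < \<rho>"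
    with z_le have "z = \<rho>" by simp
    with M_le M show False by simp
  qed
  have "(\<rho> - z) * ?k powr (1 - \<alpha>) - ?M \<le> 0"
  proof (rule tendsto_upperbound[OF g_right])
    show "\<forall>\<^sub>F s in at_right z. g s \<le> 0"
      using eventually_at_right_real[OF z_less]
      by eventually_elim (use above in \<open>auto intro: less_imp_le\<close>)
  qed (use z_pos in auto)
  then have M_ge: "(\<rho> - z) * ?k powr (1 - \<alpha>) \<le> ?M" by simp
  have k_nonneg: "0 \<le> ?k"
    using le_right_lim[of z "z + 1"] nonneg[of "z + 1"] z_pos by linarith
  \<comment> \<open>q is the value of \<open>\<eta> powr (1 - \<alpha>)\<close> that sends (z,
    \<eta>) to \<rho>. The one-sided limits of \<open>g\<close> place it between the powers of
    \<open>?k\<close> and \<open>?l\<close>, so \<eta> lies in the interval of admissible values at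
    z; at a jump this selects a ray of the rarefaction fan.\<close>
  define q where "q = ?M / (\<rho> - z)"
  define \<eta> where "\<eta> = q powr (1 / (1 - \<alpha>))"
  have q: "0 < q" "q \<le> ?l powr (1 - \<alpha>)" "?k powr (1 - \<alpha>) \<le> q"
    using M M_le M_ge z_less by (auto simp: q_def field_simps)
  have "\<eta> \<le> (?l powr (1 - \<alpha>)) powr (1 / (1 - \<alpha>))"
    unfolding \<eta>_def using q \<alpha> by (intro powr_mono2) auto
  then have "\<eta> \<le> ?l" using l_nonneg \<alpha> by (simp add: powr_powr)
  have "(?k powr (1 - \<alpha>)) powr (1 / (1 - \<alpha>)) \<le> \<eta>"
    unfolding \<eta>_def using q \<alpha> by (intro powr_mono2) auto
  then have "?k \<le> \<eta>" using k_nonneg \<alpha> by (simp add: powr_powr)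
  have "0 < \<eta>" using q by (simp add: \<eta>_def)
  have dom: "(z, \<eta>) \<in> char_dom u0"
    using z_pos \<open>\<eta> \<le> ?l\<close> \<open>?k \<le> \<eta>\<close> \<open>0 < \<eta>\<close> by (simp add: char_dom_def)
  have "1 / (1 - \<alpha>) * (\<alpha> - 1) = - 1" using \<alpha> by (simp add: field_simps)
  then have "\<eta> powr (\<alpha> - 1) = q powr (- 1)"
    unfolding \<eta>_def powr_powr by presburger
  then have "\<eta> powr (\<alpha> - 1) = (\<rho> - z) / ?M"
    using M z_less by (simp add: powr_minus q_def del: abs_mult)
  then have "?M * \<eta> powr (\<alpha> - 1) = \<rho> - z" using M by auto
  then have "\<rho> = char_map \<alpha> u0 t (z, \<eta>)" by (simp add: char_map_def algebra_simps)
  with dom show ?thesis by blast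
qed

section \<open>Limit of the solution at infinity\<close>

text \<open>The bound \<eta> r \<le> \<open>mass u0 r\<close> controls the first summand; in the
  second, the negative exponent \<alpha> - 1 makes the power decreasing in \<eta>. Read
  contrapositively, a distant \<rho> has a small \<eta>.\<close>

lemma char_map_le:
  assumes \<alpha>: "0 < \<alpha>" "\<alpha> < 1" and t: "0 < t" and dom: "(r, \<eta>) \<in> char_dom u0" and \<delta>: "0 < \<delta>" "\<delta> \<le> \<eta>"
  shows "char_map \<alpha> u0 t (r, \<eta>) \<le> total_mass / \<delta> + \<alpha> * total_mass * \<delta> powr (\<alpha> - 1) * t"
proof -
  have r: "0 \<le> r" using dom by (simp add: char_dom_def)
  have "\<delta> * r \<le> \<eta> * r" using \<delta> r by (intro mult_right_mono)
  also have "\<dots> \<le> mass u0 r" by (rule char_dom_mult_le_mass[OF dom])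
  also have "\<dots> \<le> total_mass" by (rule mass_le_total_mass[OF r])
  finally have "r \<le> total_mass / \<delta>" using \<delta> by (simp add: field_simps)
  moreover have "\<alpha> * mass u0 r * \<eta> powr (\<alpha> - 1) * t \<le> \<alpha> * total_mass * \<delta> powr (\<alpha> - 1) * t"
    using \<alpha> t \<delta> mass_le_total_mass[OF r] mass_nonneg[OF r]
    by (intro mult_mono powr_mono2') (auto intro!: mult_nonneg_nonneg)
  ultimately show ?thesis by (simp add: char_map_def)
qed

lemma tendsto_char_sol:
  assumes \<alpha>: "0 < \<alpha>" "\<alpha> < 1" and t: "0 < t"
  shows "(char_sol \<alpha> u0 t \<longlongrightarrow> total_mass) at_top"
proof -
  \<comment> \<open>By surjectivity, \<open>inv_into\<close> returns a true preimage at each \<rho>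
    > 0; the estimates hold for whichever preimage it is.\<close>
  define \<rho>0 \<eta> where "\<rho>0 \<rho> = fst (inv_into (char_dom u0) (char_map \<alpha> u0 t) \<rho>)"
    and "\<eta> \<rho> = snd (inv_into (char_dom u0) (char_map \<alpha> u0 t) \<rho>)" for \<rho>
  have dom: "(\<rho>0 \<rho>, \<eta> \<rho>) \<in> char_dom u0"
    and map: "char_map \<alpha> u0 t (\<rho>0 \<rho>, \<eta> \<rho>) = \<rho>" if "0 < \<rho>" for \<rho>
    using inv_into_into[OF char_map_surj[OF \<alpha> t that]] f_inv_into_f[OF char_map_surj[OF \<alpha> t that]]
    by (simp_all add: \<rho>0_def \<eta>_def)
  define w where "w \<delta> = (1 + \<alpha> * \<delta> powr \<alpha> * t) powr (1 - 1 / \<alpha>)" for \<delta>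
  have sol: "char_sol \<alpha> u0 t \<rho> = mass u0 (\<rho>0 \<rho>) * w (\<eta> \<rho>)" for \<rho>
    using t by (simp add: char_sol_def \<rho>0_def \<eta>_def w_def case_prod_beta)
  have w_le: "w \<delta> \<le> 1" for \<delta>
  proof -
    \<comment> \<open>The base of \<open>w\<close> is at least 1, and its exponent 1 - 1 / \<alpha>
      is negative.\<close>
    have "0 \<le> \<alpha> * \<delta> powr \<alpha> * t" using \<alpha> t by simp
    then show ?thesis
      unfolding w_def using powr_mono[of "1 - 1 / \<alpha>" 0 "1 + \<alpha> * \<delta> powr \<alpha> * t"] \<alpha> by simp
  qed
  have \<rho>0: "0 \<le> \<rho>0 \<rho>" and \<eta>_pos: "0 < \<eta> \<rho>" if "0 < \<rho>" for \<rho>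
    using dom[OF that] by (simp_all add: char_dom_def)
  have \<eta>_lim: "(\<eta> \<longlongrightarrow> 0) at_top"
  proof (rule order_tendstoI)
    fix a :: real assume "a < 0"
    show "\<forall>\<^sub>F \<rho> in at_top. a < \<eta> \<rho>"
      using eventually_gt_at_top[of 0] by eventually_elim (use \<eta>_pos \<open>a < 0\<close> in force)
  next
    fix \<delta> :: real assume \<delta>: "0 < \<delta>"
    show "\<forall>\<^sub>F \<rho> in at_top. \<eta> \<rho> < \<delta>"
      using eventually_gt_at_top[of 0]
        eventually_gt_at_top[of "total_mass / \<delta> + \<alpha> * total_mass * \<delta> powr (\<alpha> - 1) * t"]
    proof eventually_elim
      case (elim \<rho>)
      show ?case
        using char_map_le[OF \<alpha> t dom[OF elim(1)] \<delta>] map[OF elim(1)] elim by linarith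
    qed
  qed
  show ?thesis
  proof (rule order_tendstoI)
    fix a assume "total_mass < a"
    show "\<forall>\<^sub>F \<rho> in at_top. char_sol \<alpha> u0 t \<rho> < a"
      using eventually_gt_at_top[of 0]
    proof eventually_elim
      case (elim \<rho>)
      have "mass u0 (\<rho>0 \<rho>) * w (\<eta> \<rho>) \<le> mass u0 (\<rho>0 \<rho>) * 1"
        by (rule mult_left_mono[OF w_le mass_nonneg[OF \<rho>0[OF elim]]])
      then show ?case
        using mass_le_total_mass[OF \<rho>0[OF elim]] \<open>total_mass < a\<close> sol by simp
    qed
  next
    fix a assume "a < total_mass"
    \<comment> \<open>R is fixed before \<rho> grows, so that \<eta> R tends to 0 and the lower
      bound from \<open>char_dom_mass_ge\<close>, times \<open>w\<close>, tends to
      \<open>mass u0 R\<close> > a.\<close>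
    then have "\<forall>\<^sub>F R in at_top. a < mass u0 R \<and> 0 \<le> R"
      by (intro eventually_conj order_tendstoD(1)[OF tendsto_mass_at_top] eventually_ge_at_top)
    then obtain R where R: "a < mass u0 R" "0 \<le> R"
      using eventually_happens[of _ "at_top :: real filter"] by auto
    have "\<forall>\<^sub>F \<rho> in at_top. 0 \<le> \<eta> \<rho>"
      using eventually_gt_at_top[of 0] by eventually_elim (use \<eta>_pos in \<open>auto intro: less_imp_le\<close>)
    then have \<eta>_powr: "((\<lambda>\<rho>. \<eta> \<rho> powr \<alpha>) \<longlongrightarrow> 0 powr \<alpha>) at_top"
      using \<alpha> \<eta>_lim by (intro tendsto_powr') auto
    have "((\<lambda>\<rho>. w (\<eta> \<rho>)) \<longlongrightarrow> (1 + \<alpha> * 0 powr \<alpha> * t) powr (1 - 1 / \<alpha>)) at_top"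
      unfolding w_def by (intro tendsto_powr tendsto_add tendsto_mult tendsto_const \<eta>_powr) simp
    then have "((\<lambda>\<rho>. (mass u0 R - \<eta> \<rho> * R) * w (\<eta> \<rho>)) \<longlongrightarrow> (mass u0 R - 0 * R) * 1) at_top"
      using \<eta>_lim by (intro tendsto_intros) auto
    then have "\<forall>\<^sub>F \<rho> in at_top. a < (mass u0 R - \<eta> \<rho> * R) * w (\<eta> \<rho>)"
      by (rule order_tendstoD(1)) (use R in auto)
    then show "\<forall>\<^sub>F \<rho> in at_top. a < char_sol \<alpha> u0 t \<rho>"
      using eventually_gt_at_top[of 0]
    proof eventually_elim
      case (elim \<rho>)
      have "(mass u0 R - \<eta> \<rho> * R) * w (\<eta> \<rho>) \<le> mass u0 (\<rho>0 \<rho>) * w (\<eta> \<rho>)"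
        by (rule mult_right_mono[OF char_dom_mass_ge[OF dom[OF elim(2)] R(2)]]) (simp add: w_def)
      then show ?case using elim(1) sol by simp
    qed
  qed
qed

end

theorem proposition4p4:
  fixes \<alpha> t :: real and u0 :: "real \<Rightarrow> real"
  assumes "0 < \<alpha>" and "\<alpha> < 1"
    and "set_integrable lebesgue {0..} u0"
    and "\<exists>C. AE s in lebesgue. s \<ge> 0 \<longrightarrow> \<bar>u0 s\<bar> \<le> C"
    and "\<And>s. s \<ge> 0 \<Longrightarrow> u0 s \<ge> 0"
    and "\<not> (AE s in lebesgue. s \<ge> 0 \<longrightarrow> u0 s = 0)"
    and "antimono_on {0..} u0"
    and "t \<ge> 0"
  shows "\<exists>L. (mass u0 \<longlongrightarrow> L) at_top \<and> (char_sol \<alpha> u0 t \<longlongrightarrow> L) at_top"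
proof -
  interpret decreasing_datum u0
    by unfold_locales (fact assms)+
  show ?thesis
  proof (cases "t = 0")
    case True
    then have "char_sol \<alpha> u0 t = mass u0" by (simp add: char_sol_def fun_eq_iff)
    then show ?thesis using tendsto_mass_at_top by auto
  next
    case False
    then show ?thesis using tendsto_mass_at_top tendsto_char_sol[of \<alpha> t] assms by auto
  qed
qed

end
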